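(* Let $K$ be a compact linear operator on a complex Hilbert space, let $I$ be the identity operator, and let $\lambda\in\mathbb{C}$. Then $\lambda I+K$ is not norm-unimodal.
   Context: A bounded linear operator $T$ on a Banach space $X$ (in particular, on a Hilbert space) is called norm-unimodal if there is a constant $r>1$ such that for every $m\in\mathbb{N}$ there exists a nonzero vector $x_m\in X$ satisfying $\lim_{k\to\infty}\|T^k x_m\|=0$ and $\|T^i x_m\|\ge r^i\|x_m\|$ for $i=1,2,\ldots,m$. *)

theory Defs
  imports "HOL-Analysis.Analysis"
begin

class complex_vector = real_vector +
  fixes scaleC :: "complex \<Rightarrow> 'a \<Rightarrow> 'a"  (infixr "*\<^sub>C" 75)
  assumes scaleC_add_right: "a *\<^sub>C (x + y) = a *\<^sub>C x + a *\<^sub>C y"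
    and scaleC_add_left: "(a + b) *\<^sub>C x = a *\<^sub>C x + b *\<^sub>C x"
    and scaleC_scaleC: "a *\<^sub>C (b *\<^sub>C x) = (a * b) *\<^sub>C x"
    and scaleC_one: "1 *\<^sub>C x = x"
    and scaleR_scaleC: "r *\<^sub>R x = complex_of_real r *\<^sub>C x"

lemma vector_space_scaleC:
  "vector_space (scaleC :: complex \<Rightarrow> 'a \<Rightarrow> 'a::complex_vector)"
  by unfold_locales (simp_all add: scaleC_add_right scaleC_add_left scaleC_scaleC scaleC_one)

(* The real inner product is the real part of the complex one, so the superclass
   real_inner makes norm, metric and topology those induced by cinner.
   The form cinner is linear in its first argument. *)
class complex_inner = complex_vector + real_inner +
  fixes cinner :: "'a \<Rightarrow> 'a \<Rightarrow> complex"
  assumes cinner_commute: "cinner x y = cnj (cinner y x)"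
    and cinner_add_left: "cinner (x + y) z = cinner x z + cinner y z"
    and cinner_scaleC_left: "cinner (a *\<^sub>C x) y = a * cinner x y"
    and inner_eq_Re_cinner: "inner x y = Re (cinner x y)"

lemma cinner_self:
  fixes x :: "'a::complex_inner"
  shows "cinner x x = complex_of_real ((norm x)\<^sup>2)"
proof (rule complex_eqI)
  show "Re (cinner x x) = Re (complex_of_real ((norm x)\<^sup>2))"
    by (simp add: inner_eq_Re_cinner[symmetric] power2_norm_eq_inner)
  have "Im (cinner x x) = - Im (cinner x x)"
    by (subst cinner_commute) simp
  then show "Im (cinner x x) = Im (complex_of_real ((norm x)\<^sup>2))"
    by simp
qed

class chilbert_space = complex_inner + complete_space

subclass (in chilbert_space) banach ..

instantiation complex :: chilbert_space
begin

definition scaleC_complex :: "complex \<Rightarrow> complex \<Rightarrow> complex"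
  where "scaleC_complex a x = a * x"

definition cinner_complex :: "complex \<Rightarrow> complex \<Rightarrow> complex"
  where "cinner_complex x y = x * cnj y"

instance
  by standard
    (simp_all add: scaleC_complex_def cinner_complex_def algebra_simps
      scaleR_conv_of_real inner_complex_def)

end

abbreviation clinear :: "('a::complex_vector \<Rightarrow> 'b::complex_vector) \<Rightarrow> bool"
  where "clinear \<equiv> Vector_Spaces.linear scaleC scaleC"

definition compact_operator :: "('a::complex_inner \<Rightarrow> 'b::complex_inner) \<Rightarrow> bool"
  where "compact_operator K \<longleftrightarrow>
    clinear K \<and> (\<forall>B. bounded B \<longrightarrow> compact (closure (K ` B)))"

(* Intended for bounded linear T.  This is not made part of the predicate, so that
   its negation cannot hold merely because T fails to be bounded or linear. *)
definition norm_unimodal :: "('a::banach \<Rightarrow> 'a) \<Rightarrow> bool"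
  where "norm_unimodal T \<longleftrightarrow>
    (\<exists>r>1. \<forall>m::nat. \<exists>x. x \<noteq> 0 \<and>
      (\<lambda>k. norm ((T ^^ k) x)) \<longlonglongrightarrow> 0 \<and>
      (\<forall>i\<in>{1..m}. norm ((T ^^ i) x) \<ge> r ^ i * norm x))"

end

theory Submission
  imports Defs
begin

text \<open>
  Put \<open>T = l I + K\<close>. Away from \<open>l\<close> the eigenvalues of \<open>T\<close> are isolated, so there is \<open>1 < R < r\<close> with
  \<open>R \<noteq> \<bar>l\<bar>\<close> such that the circle \<open>\<bar>z\<bar> = R\<close> carries no eigenvalue of \<open>T\<close>; by compactness \<open>z I - T\<close> is
  then bounded below by some \<open>c > 0\<close>, uniformly on this circle. If \<open>T\<^sup>k x\<close> tends to \<open>0\<close>, the resolvent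
  series \<open>\<Sum>k. T\<^sup>k x / z\<^sup>k\<^sup>+\<^sup>1\<close> therefore has norm at most \<open>norm x / c\<close> on the circle, and Cauchy's
  estimate bounds \<open>norm (T\<^sup>k x)\<close> by a constant multiple of \<open>R\<^sup>k norm x\<close>. The constant does not depend
  on \<open>x\<close>, which contradicts growth at rate \<open>r\<^sup>m\<close> for large \<open>m\<close>. Only injectivity of \<open>z I - T\<close> is
  needed, so neither the size of \<open>l\<close> nor spectral projections play a role.
\<close>

section \<open>Complex scaling and first properties of compact operators\<close>

interpretation cvec: vector_space "scaleC :: complex \<Rightarrow> 'a \<Rightarrow> 'a::complex_vector"
  by (rule vector_space_scaleC)

lemma norm_scaleC: "norm (a *\<^sub>C x) = cmod a * norm (x :: 'a::complex_inner)"
proof -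
  have "cinner (a *\<^sub>C x) (a *\<^sub>C x) = a * cnj a * cinner x x"
    by (metis cinner_commute cinner_scaleC_left complex_cnj_mult mult.assoc)
  also have "a * cnj a = (complex_of_real (cmod a))\<^sup>2"
    by (metis complex_norm_square of_real_power)
  finally have "complex_of_real ((norm (a *\<^sub>C x))\<^sup>2) = complex_of_real ((cmod a * norm x)\<^sup>2)"
    by (simp add: cinner_self power_mult_distrib)
  then have "(norm (a *\<^sub>C x))\<^sup>2 = (cmod a * norm x)\<^sup>2"
    using of_real_eq_iff by blast
  then show ?thesis
    by (simp add: power2_eq_iff_nonneg)
qed

lemma bounded_bilinear_scaleC:
  "bounded_bilinear (scaleC :: complex \<Rightarrow> 'a \<Rightarrow> 'a::complex_inner)"
proof
  show "(r *\<^sub>R a) *\<^sub>C b = r *\<^sub>R (a *\<^sub>C b)" for r a and b :: 'a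
    by (simp add: scaleR_scaleC[of r "a *\<^sub>C b"] scaleC_scaleC scaleR_conv_of_real)
  show "a *\<^sub>C (r *\<^sub>R b) = r *\<^sub>R (a *\<^sub>C b)" for r a and b :: 'a
    by (simp add: scaleR_scaleC scaleC_scaleC mult.commute)
  show "\<exists>C. \<forall>a (b::'a). norm (a *\<^sub>C b) \<le> norm a * norm b * C"
    by (rule exI[of _ 1]) (simp add: norm_scaleC)
qed (simp_all add: scaleC_add_left scaleC_add_right)

lemma clinearD:
  assumes "clinear f"
  shows "f (x + y) = f x + f y" "f (a *\<^sub>C x) = a *\<^sub>C f x" "f (r *\<^sub>R x) = r *\<^sub>R f x"
    "f 0 = 0" "f (x - y) = f x - f y"
proof -
  interpret Vector_Spaces.linear scaleC scaleC f by fact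
  show "f (x + y) = f x + f y" "f (a *\<^sub>C x) = a *\<^sub>C f x" "f (r *\<^sub>R x) = r *\<^sub>R f x"
    "f 0 = 0" "f (x - y) = f x - f y"
    by (simp_all add: add scale zero diff scaleR_scaleC)
qed

text \<open>The image of the unit ball has compact closure, hence is bounded, and homogeneity
  extends the bound to all vectors. The resulting continuity of \<open>K\<close> is what later
  identifies a limit as an eigenvector.\<close>

lemma compact_operator_bounded_linear:
  assumes "compact_operator K"
  shows "bounded_linear K"
proof -
  have lin: "clinear K" and comp: "compact (closure (K ` cball 0 1))"
    using assms by (simp_all add: compact_operator_def)
  obtain B where B: "\<And>x. norm x \<le> 1 \<Longrightarrow> norm (K x) \<le> B"
    using compact_imp_bounded[OF comp] closure_subset[of "K ` cball 0 1"]
    by (force simp: bounded_iff)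
  have "norm (K x) \<le> norm x * B" for x
  proof (cases "x = 0")
    case False
    then have "norm (K ((1 / norm x) *\<^sub>R x)) \<le> B"
      by (intro B) simp
    with False show ?thesis
      by (simp add: clinearD[OF lin] field_simps)
  qed (simp add: clinearD[OF lin])
  then show ?thesis
    by (intro bounded_linear_intro[of K B]) (simp_all add: clinearD[OF lin])
qed

lemma compact_operator_convergent_subseq:
  assumes "compact_operator K" and "\<And>n. norm (u n) \<le> B"
  obtains w s where "strict_mono (s :: nat \<Rightarrow> nat)" "(\<lambda>n. K (u (s n))) \<longlonglongrightarrow> w"
proof -
  have "compact (closure (K ` cball 0 B))"
    using assms(1) by (simp add: compact_operator_def)
  moreover have "K (u n) \<in> closure (K ` cball 0 B)" for n
    using assms(2) closure_subset by fastforce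
  ultimately show thesis
    using that unfolding compact_def o_def by (elim allE[of _ "\<lambda>n. K (u n)"]) blast
qed

section \<open>Eigenvalues of a compact operator away from zero\<close>

text \<open>One Gram-Schmidt step per element of \<open>B\<close>: the new vector \<open>b\<close>
  is replaced by its part \<open>e\<close> orthogonal to the old span, and the projection of
  \<open>x\<close> gains its component along \<open>e\<close>.\<close>

lemma orthogonal_projection_cspan:
  fixes x :: "'a::complex_inner"
  assumes "finite B"
  shows "\<exists>a\<in>cvec.span B. \<forall>y\<in>cvec.span B. cinner (x - a) y = 0"
  using assms
proof (induction B arbitrary: x)
  case empty
  then show ?case
    using cinner_scaleC_left[of 0] by (metis cinner_commute complex_cnj_zero cvec.scale_zero_left
        cvec.span_empty mult_zero_left singletonD singletonI)
next
  case (insert b B)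
  obtain a where a: "a \<in> cvec.span B" "\<And>y. y \<in> cvec.span B \<Longrightarrow> cinner (x - a) y = 0"
    using insert.IH by blast
  obtain p where p: "p \<in> cvec.span B" "\<And>y. y \<in> cvec.span B \<Longrightarrow> cinner (b - p) y = 0"
    using insert.IH by blast
  define e where "e = b - p"
  define c where "c = cinner (x - a) e / cinner e e"
  \<comment> \<open>If \<open>b\<close> already lies in the span of \<open>B\<close>, then
    \<open>e = 0\<close>, and division by zero makes \<open>c = 0\<close>. This fact keeps
    \<open>c * cinner e e = cinner (x - a) e\<close> true in that case.\<close>
  have zero: "cinner e e = 0 \<Longrightarrow> cinner z e = 0" for z
    using cinner_scaleC_left[of 0 0 z] by (auto simp: cinner_self cinner_commute[of z])
  have sub: "cvec.span B \<subseteq> cvec.span (insert b B)"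
    by (intro cvec.span_mono) auto
  show ?case
  proof (intro bexI ballI)
    show "a + c *\<^sub>C e \<in> cvec.span (insert b B)"
      unfolding e_def using a(1) p(1) sub
      by (intro cvec.span_add cvec.span_scale cvec.span_diff) (auto intro: cvec.span_base)
  next
    fix y assume "y \<in> cvec.span (insert b B)"
    then obtain k where "y - k *\<^sub>C b \<in> cvec.span B"
      by (auto simp: cvec.span_breakdown_eq)
    then have w: "y - k *\<^sub>C b + k *\<^sub>C p \<in> cvec.span B"
      using p(1) by (intro cvec.span_add cvec.span_scale)
    define w where "w = y - k *\<^sub>C b + k *\<^sub>C p"
    have y: "y = k *\<^sub>C e + w"
      by (simp add: w_def e_def cvec.scale_right_diff_distrib)
    have split: "cinner z y = cnj k * cinner z e + cinner z w" for z
      unfolding y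
      by (metis cinner_add_left cinner_commute cinner_scaleC_left complex_cnj_add complex_cnj_mult)
    have "cinner (x - a) y = cnj k * cinner (x - a) e" "cinner e y = cnj k * cinner e e"
      using a(2)[of w] p(2)[of w] w by (simp_all add: split w_def[symmetric] e_def[symmetric])
    moreover have "cinner (x - a) y = cinner (x - (a + c *\<^sub>C e)) y + c * cinner e y"
      by (simp add: cinner_add_left[symmetric] cinner_scaleC_left[symmetric])
    moreover have "c * cinner e e = cinner (x - a) e"
      using zero by (simp add: c_def)
    ultimately show "cinner (x - (a + c *\<^sub>C e)) y = 0"
      by (metis add_cancel_left_left mult.left_commute)
  qed
qed

text \<open>A span of eigenvectors is invariant under \<open>K\<close>, hence under every shift of
  it; \<open>c = 0\<close> gives invariance under \<open>K\<close> itself.\<close>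

lemma eigenvalue_shift_cspan:
  assumes K: "clinear K" and eig: "\<And>i. K (v i) = \<mu> i *\<^sub>C v i"
    and x: "x \<in> cvec.span (v ` {..<n::nat})"
  shows "K x - c *\<^sub>C x \<in> cvec.span (v ` {..<n})"
  using x
proof (induction rule: cvec.span_induct_alt)
  case (step a y w)
  then obtain i where "i < n" "y = v i" by auto
  moreover have "K (a *\<^sub>C y + w) - c *\<^sub>C (a *\<^sub>C y + w) = (a * (\<mu> i - c)) *\<^sub>C v i + (K w - c *\<^sub>C w)"
    if "y = v i"
    using that
    by (simp add: clinearD[OF K] eig cvec.scale_right_distrib scaleC_scaleC algebra_simps)
  ultimately show ?case
    using step by (simp add: cvec.span_add cvec.span_scale cvec.span_base)
qed (simp add: clinearD[OF K] cvec.span_zero)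

text \<open>Shifting \<open>K\<close> by \<open>\<mu> i\<close> annihilates \<open>v i\<close>, so a
  relation between \<open>v i\<close> and the earlier vectors turns into one for \<open>v n\<close>
  alone, with nonzero factor \<open>\<mu> n - \<mu> i\<close>. The claim covers all \<open>i\<close>
  from \<open>n\<close> on because the induction hypothesis is applied both to \<open>v n\<close>
  and to \<open>v i\<close>.\<close>

lemma eigenvector_notin_cspan:
  fixes \<mu> :: "nat \<Rightarrow> complex"
  assumes K: "clinear K" and eig: "\<And>i. K (v i) = \<mu> i *\<^sub>C v i"
    and nz: "\<And>i. v i \<noteq> 0" and "inj \<mu>" and "n \<le> i"
  shows "v i \<notin> cvec.span (v ` {..<n})"
  using \<open>n \<le> i\<close>
proof (induction n arbitrary: i)
  case 0
  then show ?case using nz by simp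
next
  case (Suc n)
  show ?case
  proof
    assume "v i \<in> cvec.span (v ` {..<Suc n})"
    then obtain k where k: "v i - k *\<^sub>C v n \<in> cvec.span (v ` {..<n})"
      by (auto simp: lessThan_Suc cvec.span_breakdown_eq)
    define w where "w = v i - k *\<^sub>C v n"
    have "K w - \<mu> i *\<^sub>C w = - ((k * (\<mu> n - \<mu> i)) *\<^sub>C v n)"
      by (simp add: w_def clinearD[OF K] eig cvec.scale_right_diff_distrib scaleC_scaleC algebra_simps)
    moreover have "K w - \<mu> i *\<^sub>C w \<in> cvec.span (v ` {..<n})"
      using k eigenvalue_shift_cspan[OF K eig] by (simp add: w_def)
    ultimately have "(k * (\<mu> n - \<mu> i)) *\<^sub>C v n \<in> cvec.span (v ` {..<n})"
      by (metis cvec.span_neg minus_minus)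
    moreover have "\<mu> n \<noteq> \<mu> i"
      using \<open>inj \<mu>\<close> Suc.prems by (auto dest: injD)
    ultimately have "k = 0"
      using Suc.IH[of n] cvec.span_scale[of "(k * (\<mu> n - \<mu> i)) *\<^sub>C v n" _ "inverse (k * (\<mu> n - \<mu> i))"]
      by (cases "k = 0") (auto simp: scaleC_scaleC scaleC_one simp del: inverse_mult_distrib)
    with k Suc.IH[of i] Suc.prems show False by simp
  qed
qed

text \<open>The argument of Riesz: infinitely many such eigenvalues would give an orthonormal
  sequence \<open>u\<close>, adapted to the flag \<open>V\<close> of eigenvector spans, whose images
  under \<open>K\<close> keep mutual distance at least \<open>\<epsilon>\<close>. No subsequence of
  these images could converge.\<close>

lemma finite_eigenvalues_compact_operator:
  fixes K :: "'a::complex_inner \<Rightarrow> 'a"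
  assumes comp: "compact_operator K" and "\<epsilon> > 0"
  shows "finite {\<mu>. \<epsilon> \<le> cmod \<mu> \<and> (\<exists>v. v \<noteq> 0 \<and> K v = \<mu> *\<^sub>C v)}" (is "finite ?E")
proof (rule ccontr)
  assume "infinite ?E"
  from infinite_countable_subset[OF this]
  obtain \<mu> :: "nat \<Rightarrow> complex" where "inj \<mu>" and "range \<mu> \<subseteq> ?E"
    by (elim exE conjE)
  from \<open>range \<mu> \<subseteq> ?E\<close> have E: "\<mu> n \<in> ?E" for n
    by (rule subsetD) (rule rangeI)
  then have big: "\<epsilon> \<le> cmod (\<mu> n)" for n
    by simp
  have "\<exists>v. v \<noteq> 0 \<and> K v = \<mu> n *\<^sub>C v" for n
    using E[of n] by simp
  then obtain v where nz: "\<And>n. v n \<noteq> 0" and eig: "\<And>n. K (v n) = \<mu> n *\<^sub>C v n"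
    by metis
  have K: "clinear K"
    using comp by (simp add: compact_operator_def)
  define V where "V n = cvec.span (v ` {..<n})" for n
  have V_mono: "V m \<subseteq> V n" if "m \<le> n" for m n
    unfolding V_def using that by (intro cvec.span_mono) auto
  have "\<exists>u. norm u = 1 \<and> u \<in> V (Suc n) \<and> (\<forall>y\<in>V n. cinner u y = 0) \<and> K u - \<mu> n *\<^sub>C u \<in> V n" for n
  proof -
    obtain a where a: "a \<in> V n" and orth: "\<And>y. y \<in> V n \<Longrightarrow> cinner (v n - a) y = 0"
      using orthogonal_projection_cspan[of "v ` {..<n}"] unfolding V_def by blast
    define d where "d = v n - a"
    have "d \<noteq> 0"
      using a eigenvector_notin_cspan[OF K eig nz \<open>inj \<mu>\<close>, of n n] by (auto simp: d_def V_def)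
    have "v n \<in> V (Suc n)" "a \<in> V (Suc n)"
      using a V_mono[of n "Suc n"] by (auto simp: V_def intro: cvec.span_base)
    then have d: "d \<in> V (Suc n)"
      by (simp add: d_def V_def cvec.span_diff)
    \<comment> \<open>The contribution of \<open>v n\<close> cancels, being an eigenvector for
      \<open>\<mu> n\<close>, so only that of \<open>a\<close> remains, and it stays in
      \<open>V n\<close>.\<close>
    have "K d - \<mu> n *\<^sub>C d = - (K a - \<mu> n *\<^sub>C a)"
      by (simp add: d_def clinearD[OF K] eig cvec.scale_right_diff_distrib)
    moreover have "K a - \<mu> n *\<^sub>C a \<in> V n"
      using a eigenvalue_shift_cspan[OF K eig] by (simp add: V_def)
    ultimately have Kd: "K d - \<mu> n *\<^sub>C d \<in> V n"
      unfolding V_def by (metis cvec.span_neg)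
    define t where "t = complex_of_real (1 / norm d)"
    have "K (t *\<^sub>C d) - \<mu> n *\<^sub>C (t *\<^sub>C d) = t *\<^sub>C (K d - \<mu> n *\<^sub>C d)"
      by (simp add: clinearD[OF K] cvec.scale_right_diff_distrib cvec.scale_left_commute)
    then have "norm (t *\<^sub>C d) = 1 \<and> t *\<^sub>C d \<in> V (Suc n) \<and> (\<forall>y\<in>V n. cinner (t *\<^sub>C d) y = 0)
      \<and> K (t *\<^sub>C d) - \<mu> n *\<^sub>C (t *\<^sub>C d) \<in> V n"
      using \<open>d \<noteq> 0\<close> d Kd orth
      by (auto simp: t_def norm_scaleC cinner_scaleC_left V_def norm_divide d_def[symmetric]
          intro!: cvec.span_scale)
    then show ?thesis by blast
  qed
  then obtain u where u: "\<And>n. norm (u n) = 1" "\<And>n. u n \<in> V (Suc n)"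
      "\<And>n y. y \<in> V n \<Longrightarrow> cinner (u n) y = 0" "\<And>n. K (u n) - \<mu> n *\<^sub>C u n \<in> V n"
    by metis
  have far: "\<epsilon> \<le> norm (K (u n) - K (u m))" if "m < n" for m n
  proof -
    \<comment> \<open>With this \<open>w\<close>, the difference of the images is
      \<open>\<mu> n *\<^sub>C u n + w\<close>. Since \<open>w\<close> lies in \<open>V n\<close>,
      it is orthogonal to \<open>u n\<close>, and Pythagoras leaves at least
      \<open>cmod (\<mu> n)\<close>.\<close>
    define w where "w = (K (u n) - \<mu> n *\<^sub>C u n) - K (u m)"
    have "u m \<in> V n" "K (u m) \<in> V n"
    proof -
      show "u m \<in> V n"
        using u(2)[of m] V_mono[of "Suc m" n] that by auto
      then show "K (u m) \<in> V n"
        using eigenvalue_shift_cspan[OF K eig, where x = "u m" and n = n and c = 0] by (simp add: V_def)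
    qed
    then have "w \<in> V n"
      using u(4)[of n] by (simp add: w_def V_def cvec.span_diff)
    then have "inner (\<mu> n *\<^sub>C u n) w = 0"
      by (simp add: inner_eq_Re_cinner cinner_scaleC_left u(3))
    then have "(norm (\<mu> n *\<^sub>C u n + w))\<^sup>2 = (norm (\<mu> n *\<^sub>C u n))\<^sup>2 + (norm w)\<^sup>2"
      by (intro norm_add_Pythagorean) (simp add: orthogonal_def)
    then have "(norm (\<mu> n *\<^sub>C u n))\<^sup>2 \<le> (norm (\<mu> n *\<^sub>C u n + w))\<^sup>2"
      by simp
    then have "norm (\<mu> n *\<^sub>C u n) \<le> norm (\<mu> n *\<^sub>C u n + w)"
      using power2_le_imp_le norm_ge_zero by blast
    with big[of n] show ?thesis
      by (simp add: norm_scaleC u(1) w_def)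
  qed
  obtain w s where s: "strict_mono s" and lim: "(\<lambda>n. K (u (s n))) \<longlonglongrightarrow> w"
    using compact_operator_convergent_subseq[OF comp, of u 1] u(1) by (metis order_refl)
  obtain N where "\<And>m n. m \<ge> N \<Longrightarrow> n \<ge> N \<Longrightarrow> norm (K (u (s m)) - K (u (s n))) < \<epsilon>"
    using LIMSEQ_imp_Cauchy[OF lim] \<open>\<epsilon> > 0\<close> unfolding Cauchy_iff by blast
  from this[of "Suc N" N] far[of "s N" "s (Suc N)"] s show False
    by (simp add: strict_mono_Suc_iff)
qed

section \<open>A uniform lower bound on an eigenvalue-free circle\<close>

text \<open>Failure yields approximate unit eigenvectors \<open>y n\<close> at points
  \<open>z n\<close> of the circle. Compactness of \<open>K\<close> and of the circle makes
  \<open>K (y n)\<close> and \<open>z n\<close> converge along a subsequence; as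
  \<open>R \<noteq> cmod l\<close> permits division by \<open>z n - l\<close>, the
  \<open>y n\<close> converge too, to a unit vector that \<open>no_eig\<close> forces to
  vanish.\<close>

lemma uniform_lower_bound_on_circle:
  fixes K :: "'a::complex_inner \<Rightarrow> 'a"
  assumes comp: "compact_operator K" and R: "R \<noteq> cmod l"
    and no_eig: "\<And>z y. cmod z = R \<Longrightarrow> K y = (z - l) *\<^sub>C y \<Longrightarrow> y = 0"
  obtains c where "c > 0"
    "\<And>z y. cmod z = R \<Longrightarrow> c * norm y \<le> norm ((z - l) *\<^sub>C y - K y)"
proof (rule ccontr)
  assume "\<not> thesis"
  then have "\<not> (\<exists>c>0. \<forall>z y. cmod z = R \<longrightarrow> c * norm y \<le> norm ((z - l) *\<^sub>C y - K y))"
    using that by blast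
  then have ex: "\<exists>z y. cmod z = R \<and> norm ((z - l) *\<^sub>C y - K y) < inverse (real (Suc n)) * norm y" for n
    by (meson inverse_positive_iff_positive not_le of_nat_0_less_iff zero_less_Suc)
  have K: "clinear K"
    using comp by (simp add: compact_operator_def)
  have "\<exists>z y. cmod z = R \<and> norm y = 1 \<and> norm ((z - l) *\<^sub>C y - K y) < inverse (real (Suc n))" for n
  proof -
    obtain z y where zy: "cmod z = R" "norm ((z - l) *\<^sub>C y - K y) < inverse (real (Suc n)) * norm y"
      using ex by blast
    then have "y \<noteq> 0" by auto
    define t where "t = 1 / norm y"
    have "(z - l) *\<^sub>C (t *\<^sub>R y) - K (t *\<^sub>R y) = t *\<^sub>R ((z - l) *\<^sub>C y - K y)"
      by (simp add: clinearD[OF K] scaleR_scaleC cvec.scale_right_diff_distrib cvec.scale_left_commute)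
    then have "norm ((z - l) *\<^sub>C (t *\<^sub>R y) - K (t *\<^sub>R y)) = norm ((z - l) *\<^sub>C y - K y) / norm y"
      by (simp add: t_def)
    also have "\<dots> < inverse (real (Suc n))"
      using zy(2) \<open>y \<noteq> 0\<close> by (subst pos_divide_less_eq) auto
    finally have "norm ((z - l) *\<^sub>C (t *\<^sub>R y) - K (t *\<^sub>R y)) < inverse (real (Suc n))" .
    moreover have "norm (t *\<^sub>R y) = 1"
      using \<open>y \<noteq> 0\<close> by (simp add: t_def)
    ultimately show ?thesis using zy(1) by blast
  qed
  then obtain z y where z: "\<And>n. cmod (z n) = R" and y: "\<And>n. norm (y n) = 1"
      and small: "\<And>n. norm ((z n - l) *\<^sub>C y n - K (y n)) < inverse (real (Suc n))"
    by metis
  obtain w s where s: "strict_mono s" and Ky: "(\<lambda>n. K (y (s n))) \<longlonglongrightarrow> w"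
    using compact_operator_convergent_subseq[OF comp, of y 1] y by (metis order_refl)
  have "compact (sphere (0::complex) R)" "\<And>n. z (s n) \<in> sphere 0 R"
    using z by auto
  then obtain \<zeta> s' where s': "strict_mono s'" and \<zeta>: "\<zeta> \<in> sphere 0 R"
      and lim_z: "(\<lambda>n. z (s (s' n))) \<longlonglongrightarrow> \<zeta>"
    unfolding compact_def o_def by (elim allE[of _ "\<lambda>n. z (s n)"]) blast
  define q where "q = s \<circ> s'"
  have q: "strict_mono q"
    using s s' by (simp add: q_def strict_mono_o)
  have lim_Ky: "(\<lambda>n. K (y (q n))) \<longlonglongrightarrow> w"
    using LIMSEQ_subseq_LIMSEQ[OF Ky s'] by (simp add: q_def o_def)
  have "(\<lambda>n. (z n - l) *\<^sub>C y n - K (y n)) \<longlonglongrightarrow> 0"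
  proof (rule Lim_null_comparison[OF _ LIMSEQ_inverse_real_of_nat])
    show "\<forall>\<^sub>F n in sequentially. norm ((z n - l) *\<^sub>C y n - K (y n)) \<le> inverse (real (Suc n))"
      using small by (intro always_eventually allI less_imp_le)
  qed
  from LIMSEQ_subseq_LIMSEQ[OF this q]
  have "(\<lambda>n. ((z (q n) - l) *\<^sub>C y (q n) - K (y (q n))) + K (y (q n))) \<longlonglongrightarrow> 0 + w"
    unfolding o_def by (intro tendsto_add lim_Ky)
  then have "(\<lambda>n. (z (q n) - l) *\<^sub>C y (q n)) \<longlonglongrightarrow> w"
    by simp
  moreover have nz: "\<zeta> - l \<noteq> 0" "z n - l \<noteq> 0" for n
    using \<zeta> z R by auto
  then have "(\<lambda>n. inverse (z (q n) - l)) \<longlonglongrightarrow> inverse (\<zeta> - l)"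
    using lim_z by (intro tendsto_intros) (auto simp: q_def)
  ultimately have
    "(\<lambda>n. inverse (z (q n) - l) *\<^sub>C ((z (q n) - l) *\<^sub>C y (q n))) \<longlonglongrightarrow> inverse (\<zeta> - l) *\<^sub>C w"
    by (intro bounded_bilinear.tendsto[OF bounded_bilinear_scaleC])
  then have lim_y: "(\<lambda>n. y (q n)) \<longlonglongrightarrow> inverse (\<zeta> - l) *\<^sub>C w"
    using nz by (simp add: scaleC_scaleC scaleC_one)
  have "w = K (inverse (\<zeta> - l) *\<^sub>C w)"
    using bounded_linear.tendsto[OF compact_operator_bounded_linear[OF comp] lim_y] lim_Ky
    by (rule LIMSEQ_unique[symmetric])
  then have "K (inverse (\<zeta> - l) *\<^sub>C w) = (\<zeta> - l) *\<^sub>C (inverse (\<zeta> - l) *\<^sub>C w)"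
    using nz by (simp add: scaleC_scaleC scaleC_one)
  then have "inverse (\<zeta> - l) *\<^sub>C w = 0"
    using \<zeta> by (intro no_eig[of \<zeta>]) auto
  moreover have "norm (inverse (\<zeta> - l) *\<^sub>C w) = 1"
    using tendsto_norm[OF lim_y] y by (simp add: LIMSEQ_const_iff)
  ultimately show False
    by (metis norm_zero zero_neq_one)
qed

section \<open>Roots of unity and the discrete Cauchy estimate\<close>

text \<open>A geometric sum whose ratio \<open>\<omega>\<close> satisfies
  \<open>\<omega> ^ N = 1\<close>: it vanishes unless \<open>\<omega> = 1\<close>, which happens
  exactly when \<open>N\<close> divides \<open>d\<close>.\<close>

lemma sum_roots_of_unity_powers:
  assumes "0 < N"
  shows "(\<Sum>i<N. cis (2 * pi * real i / real N) ^ d) = (if N dvd d then of_nat N else 0)"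
proof -
  define \<omega> where "\<omega> = cis (2 * pi * real d / real N)"
  have "cis (2 * pi * real i / real N) ^ d = \<omega> ^ i" for i
    by (simp add: \<omega>_def Complex.DeMoivre mult.commute mult.left_commute)
  then have sum: "(\<Sum>i<N. cis (2 * pi * real i / real N) ^ d) = (\<Sum>i<N. \<omega> ^ i)"
    by simp
  have "\<omega> = exp (2 * of_real pi * \<i> * of_nat d / of_nat N)"
    by (simp add: \<omega>_def cis_conv_exp mult.commute mult.left_commute)
  then have one: "\<omega> = 1 \<longleftrightarrow> N dvd d"
    using complex_root_unity_eq_1[of N d] assms by simp
  have "\<omega> ^ N = cis (2 * pi * real d)"
    using assms by (simp add: \<omega>_def Complex.DeMoivre)
  then have "\<omega> ^ N = 1"
    by (simp add: cis_multiple_2pi)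
  then have "(1 - \<omega>) * (\<Sum>i<N. \<omega> ^ i) = 0"
    by (simp add: one_diff_power_eq[symmetric])
  then show ?thesis
    using one by (auto simp: sum)
qed

text \<open>The sum is the resolvent series truncated after \<open>N\<close> terms and multiplied by
  \<open>z ^ N\<close>. Applying \<open>z\<close> minus \<open>T\<close> telescopes, and clearing
  denominators makes the identity valid for every \<open>z\<close>.\<close>

lemma resolvent_partial_sum:
  assumes T: "clinear T"
  shows "z *\<^sub>C (\<Sum>k<N. z ^ (N - Suc k) *\<^sub>C (T ^^ k) x) - T (\<Sum>k<N. z ^ (N - Suc k) *\<^sub>C (T ^^ k) x)
    = z ^ N *\<^sub>C x - (T ^^ N) x"
proof (induction N)
  case 0
  then show ?case by (simp add: clinearD[OF T] scaleC_one)
next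
  case (Suc N)
  define Y where "Y = (\<Sum>k<N. z ^ (N - Suc k) *\<^sub>C (T ^^ k) x)"
  have "(\<Sum>k<N. z ^ (Suc N - Suc k) *\<^sub>C (T ^^ k) x) = z *\<^sub>C Y"
    unfolding Y_def cvec.scale_sum_right
    by (intro sum.cong) (auto simp: scaleC_scaleC Suc_diff_Suc simp flip: power_Suc)
  then have Y: "(\<Sum>k<Suc N. z ^ (Suc N - Suc k) *\<^sub>C (T ^^ k) x) = z *\<^sub>C Y + (T ^^ N) x"
    by (simp add: scaleC_one)
  have "z *\<^sub>C (z *\<^sub>C Y + (T ^^ N) x) - T (z *\<^sub>C Y + (T ^^ N) x)
    = z *\<^sub>C (z *\<^sub>C Y - T Y) + z *\<^sub>C (T ^^ N) x - (T ^^ Suc N) x"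
    by (simp add: clinearD[OF T] cvec.scale_right_distrib cvec.scale_right_diff_distrib)
  also have "\<dots> = z ^ Suc N *\<^sub>C x - (T ^^ Suc N) x"
    using Suc.IH by (simp add: Y_def cvec.scale_right_diff_distrib scaleC_scaleC)
  finally show ?case
    unfolding Y .
qed

text \<open>
  A discrete Cauchy estimate: the contour integral over \<open>\<bar>z\<bar> = R\<close> is replaced by the average over the
  points \<open>z\<close> with \<open>z\<^sup>N = R\<^sup>N\<close>, where the truncated resolvent series satisfies an exact identity.
\<close>

lemma norm_orbit_le:
  fixes T :: "'a::complex_inner \<Rightarrow> 'a"
  assumes T: "clinear T" and "R > 0" "c > 0" "j < N"
    and lower: "\<And>z y. cmod z = R \<Longrightarrow> c * norm y \<le> norm (z *\<^sub>C y - T y)"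
  shows "norm ((T ^^ j) x) \<le> R ^ Suc j / c * (norm x + norm ((T ^^ N) x) / R ^ N)"
proof -
  define z where "z i = complex_of_real R * cis (2 * pi * real i / real N)" for i :: nat
  define Y where "Y i = (\<Sum>k<N. z i ^ (N - Suc k) *\<^sub>C (T ^^ k) x)" for i
  have "N > 0" using \<open>j < N\<close> by simp
  have norm_z: "cmod (z i) = R" for i
    using \<open>R > 0\<close> by (simp add: z_def norm_mult)
  have "norm (Y i) \<le> (R ^ N * norm x + norm ((T ^^ N) x)) / c" for i
  proof -
    have "c * norm (Y i) \<le> norm (z i ^ N *\<^sub>C x - (T ^^ N) x)"
      using lower[OF norm_z, of "Y i" i] by (simp add: Y_def resolvent_partial_sum[OF T])
    also have "\<dots> \<le> R ^ N * norm x + norm ((T ^^ N) x)"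
      by (rule norm_triangle_le_diff) (simp add: norm_scaleC norm_power norm_z)
    finally show ?thesis
      using \<open>c > 0\<close> by (simp add: field_simps)
  qed
  then have norm_Y: "norm (z i ^ Suc j *\<^sub>C Y i) \<le> R ^ Suc j * ((R ^ N * norm x + norm ((T ^^ N) x)) / c)" for i
    unfolding norm_scaleC norm_power norm_z using \<open>R > 0\<close> by (intro mult_left_mono) auto
  \<comment> \<open>Averaging \<open>z ^ Suc j\<close> times the resolvent over the circle extracts
    the orbit vector with index \<open>j\<close>; below, orthogonality of roots of unity does the
    extraction.\<close>
  have "(\<Sum>i<N. z i ^ Suc j *\<^sub>C Y i) = (\<Sum>i<N. \<Sum>k<N. z i ^ (Suc j + (N - Suc k)) *\<^sub>C (T ^^ k) x)"
    by (simp only: Y_def cvec.scale_sum_right scaleC_scaleC power_add)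
  also have "\<dots> = (\<Sum>k<N. (\<Sum>i<N. z i ^ (Suc j + (N - Suc k))) *\<^sub>C (T ^^ k) x)"
    by (subst sum.swap) (simp only: cvec.scale_sum_left)
  also have "\<dots> = (\<Sum>k<N. (if k = j then of_nat N * of_real R ^ N else 0) *\<^sub>C (T ^^ k) x)"
  proof (intro sum.cong refl arg_cong2[where f = scaleC])
    fix k assume "k \<in> {..<N}"
    then have "k < N" by simp
    have dvd: "N dvd Suc j + (N - Suc k) \<longleftrightarrow> k = j"
    proof
      assume "N dvd Suc j + (N - Suc k)"
      then obtain t where t: "Suc j + (N - Suc k) = N * t" ..
      \<comment> \<open>The exponent is \<open>N + j - k\<close>, strictly between \<open>0\<close>
        and \<open>2 * N\<close>, so \<open>N\<close> is its only possible multiple of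
        \<open>N\<close>.\<close>
      have "0 < Suc j + (N - Suc k)" "Suc j + (N - Suc k) < N * 2"
        using \<open>k < N\<close> \<open>j < N\<close> by linarith+
      then have "t = 1"
        unfolding t by (cases t) (auto simp: \<open>N > 0\<close>)
      with t \<open>k < N\<close> show "k = j" by simp
    qed (use \<open>k < N\<close> in simp)
    have "(\<Sum>i<N. z i ^ (Suc j + (N - Suc k)))
      = of_real R ^ (Suc j + (N - Suc k)) * (if N dvd Suc j + (N - Suc k) then of_nat N else 0)"
      by (simp only: z_def power_mult_distrib sum_distrib_left[symmetric]
          sum_roots_of_unity_powers[OF \<open>N > 0\<close>])
    then show "(\<Sum>i<N. z i ^ (Suc j + (N - Suc k))) = (if k = j then of_nat N * of_real R ^ N else 0)"
      using \<open>k < N\<close> unfolding dvd by (auto simp: Suc_diff_Suc)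
  qed
  also have "\<dots> = (of_nat N * of_real R ^ N) *\<^sub>C (T ^^ j) x"
    using \<open>j < N\<close> by (simp add: if_distrib[of "\<lambda>a. a *\<^sub>C _"] cong: if_cong)
  finally have "real N * R ^ N * norm ((T ^^ j) x) = norm (\<Sum>i<N. z i ^ Suc j *\<^sub>C Y i)"
    using \<open>R > 0\<close> by (simp add: norm_scaleC norm_mult norm_power)
  also have "\<dots> \<le> real N * (R ^ Suc j * ((R ^ N * norm x + norm ((T ^^ N) x)) / c))"
    using sum_norm_le[of "{..<N}", OF norm_Y] by simp
  finally have "R ^ N * norm ((T ^^ j) x) \<le> R ^ Suc j * ((R ^ N * norm x + norm ((T ^^ N) x)) / c)"
    unfolding mult.assoc using \<open>N > 0\<close> by (subst (asm) mult_le_cancel_left_pos) auto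
  then show ?thesis
    using \<open>R > 0\<close> \<open>c > 0\<close> by (simp add: field_simps)
qed

section \<open>Choice of the circle and the contradiction\<close>

text \<open>On circles whose radius differs from \<open>cmod l\<close> by at least
  \<open>\<delta>\<close>, an eigenvalue \<open>z\<close> of \<open>T\<close> gives an eigenvalue
  \<open>z - l\<close> of \<open>K\<close> of modulus at least \<open>\<delta>\<close>. There are
  finitely many of these, so they exclude finitely many radii from an interval.\<close>

lemma exists_eigenvalue_free_circle:
  fixes K :: "'a::complex_inner \<Rightarrow> 'a"
  assumes comp: "compact_operator K" and "1 < r"
  obtains R where "1 < R" "R < r" "R \<noteq> cmod l"
    "\<And>z y. cmod z = R \<Longrightarrow> K y = (z - l) *\<^sub>C y \<Longrightarrow> y = 0"
proof -
  \<comment> \<open>The interval from \<open>1\<close> to \<open>r\<close> has length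
    \<open>4 * \<delta>\<close> and midpoint \<open>(r + 1) / 2\<close>. Its outer quarter on the
    side away from \<open>cmod l\<close> keeps distance at least \<open>\<delta>\<close> from
    \<open>cmod l\<close>.\<close>
  define \<delta> where "\<delta> = (r - 1) / 4"
  have "\<delta> > 0" using \<open>1 < r\<close> by (simp add: \<delta>_def)
  obtain a where a: "1 \<le> a" "a + \<delta> \<le> r" "\<And>R. a < R \<Longrightarrow> R < a + \<delta> \<Longrightarrow> \<delta> \<le> \<bar>R - cmod l\<bar>"
  proof (cases "cmod l \<le> (r + 1) / 2")
    case True
    show thesis
      by (rule that[of "r - \<delta>"]) (use True \<open>1 < r\<close> in \<open>auto simp: \<delta>_def field_simps\<close>)
  next
    case False
    show thesis
      by (rule that[of 1]) (use False \<open>1 < r\<close> in \<open>auto simp: \<delta>_def field_simps abs_if\<close>)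
  qed
  let ?E = "{\<mu>. \<delta> \<le> cmod \<mu> \<and> (\<exists>v. v \<noteq> 0 \<and> K v = \<mu> *\<^sub>C v)}"
  have "finite ((\<lambda>\<mu>. cmod (\<mu> + l)) ` ?E)"
    using finite_eigenvalues_compact_operator[OF comp \<open>\<delta> > 0\<close>] by simp
  moreover have "infinite {a<..<a + \<delta>}"
    using \<open>\<delta> > 0\<close> by simp
  ultimately obtain R where R: "R \<in> {a<..<a + \<delta>}" "R \<notin> (\<lambda>\<mu>. cmod (\<mu> + l)) ` ?E"
    by (meson finite_subset subsetI)
  show thesis
  proof
    have "\<delta> \<le> \<bar>R - cmod l\<bar>"
      using R(1) a(3) by simp
    then show "1 < R" "R < r" "R \<noteq> cmod l"
      using R(1) a(1,2) \<open>\<delta> > 0\<close> by auto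
    show "y = 0" if "cmod z = R" "K y = (z - l) *\<^sub>C y" for z y
    proof (rule ccontr)
      assume "y \<noteq> 0"
      moreover have "\<delta> \<le> cmod (z - l)"
        using \<open>\<delta> \<le> \<bar>R - cmod l\<bar>\<close> norm_triangle_ineq3[of z l] that(1) by simp
      ultimately have "z - l \<in> ?E"
        using that(2) by blast
      then have "cmod (z - l + l) \<in> (\<lambda>\<mu>. cmod (\<mu> + l)) ` ?E"
        by (rule imageI)
      with R(2) that(1) show False by simp
    qed
  qed
qed

theorem proposition3p3:
  fixes K :: "'a::chilbert_space \<Rightarrow> 'a" and l :: complex
  assumes "compact_operator K"
  shows "\<not> norm_unimodal (\<lambda>x. l *\<^sub>C x + K x)"
proof
  define T where "T = (\<lambda>x. l *\<^sub>C x + K x)"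
  assume "norm_unimodal (\<lambda>x. l *\<^sub>C x + K x)"
  then obtain r where "1 < r" and ex: "\<And>m::nat. \<exists>x. x \<noteq> 0 \<and> (\<lambda>k. norm ((T ^^ k) x)) \<longlonglongrightarrow> 0 \<and>
      (\<forall>i\<in>{1..m}. norm ((T ^^ i) x) \<ge> r ^ i * norm x)"
    unfolding norm_unimodal_def T_def by blast
  obtain R where R: "1 < R" "R < r" "R \<noteq> cmod l"
      and no_eig: "\<And>z y. cmod z = R \<Longrightarrow> K y = (z - l) *\<^sub>C y \<Longrightarrow> y = 0"
    using exists_eigenvalue_free_circle[OF assms \<open>1 < r\<close>, of l] by blast
  obtain c where "c > 0"
      and "\<And>z y. cmod z = R \<Longrightarrow> c * norm y \<le> norm ((z - l) *\<^sub>C y - K y)"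
    using uniform_lower_bound_on_circle[OF assms R(3)] no_eig by metis
  then have lower: "\<And>z y. cmod z = R \<Longrightarrow> c * norm y \<le> norm (z *\<^sub>C y - T y)"
    by (simp add: T_def cvec.scale_left_diff_distrib diff_diff_eq)
  have K: "clinear K"
    using assms by (simp add: compact_operator_def)
  have T: "clinear T"
    unfolding T_def Vector_Spaces.linear_iff
    by (auto simp: vector_space_scaleC clinearD[OF K] cvec.scale_right_distrib cvec.scale_left_commute)
  \<comment> \<open>The vector \<open>x\<close> changes with \<open>m\<close>, so the right-hand
    side has to be independent of both.\<close>
  have bound: "(r / R) ^ m \<le> 2 * R / c" if "m \<ge> 1" for m
  proof -
    obtain x where x: "x \<noteq> 0" and lim: "(\<lambda>k. norm ((T ^^ k) x)) \<longlonglongrightarrow> 0"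
        and grow: "\<forall>i\<in>{1..m}. norm ((T ^^ i) x) \<ge> r ^ i * norm x"
      using ex by blast
    have "\<forall>\<^sub>F k in sequentially. norm ((T ^^ k) x) < norm x"
      using order_tendstoD(2)[OF lim, of "norm x"] x by simp
    \<comment> \<open>The truncation index is chosen after \<open>x\<close> and \<open>m\<close>:
      decay of the orbit makes the remainder in \<open>norm_orbit_le\<close> at most
      \<open>norm x\<close>, whence the factor 2.\<close>
    then obtain N where N: "N > m" "norm ((T ^^ N) x) < norm x"
      by (metis (no_types, lifting) eventually_sequentially le_add1 le_add2 less_add_one
          less_le_trans add.commute)
    have "norm ((T ^^ N) x) / R ^ N \<le> norm x / 1"
      using N(2) R(1) by (intro frac_le) auto
    then have "norm x + norm ((T ^^ N) x) / R ^ N \<le> 2 * norm x"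
      by simp
    then have "R ^ Suc m / c * (norm x + norm ((T ^^ N) x) / R ^ N) \<le> R ^ Suc m / c * (2 * norm x)"
      using R(1) \<open>c > 0\<close> by (intro mult_left_mono) auto
    moreover have "r ^ m * norm x \<le> norm ((T ^^ m) x)"
      using grow that by simp
    moreover have "norm ((T ^^ m) x) \<le> R ^ Suc m / c * (norm x + norm ((T ^^ N) x) / R ^ N)"
      using R(1) by (intro norm_orbit_le[OF T _ \<open>c > 0\<close> N(1) lower]) auto
    ultimately have "r ^ m * norm x \<le> (R ^ Suc m / c * 2) * norm x"
      by linarith
    then have "r ^ m \<le> R ^ Suc m / c * 2"
      using x by (subst (asm) mult_le_cancel_right_pos) auto
    then show ?thesis
      using R(1) by (simp add: power_divide field_simps)
  qed
  have "1 < r / R"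
    using R by simp
  then obtain n where "2 * R / c < (r / R) ^ n"
    using real_arch_pow by blast
  \<comment> \<open>Passing to \<open>Suc n\<close> meets the requirement \<open>m \<ge> 1\<close>
    of \<open>bound\<close> even if \<open>n = 0\<close>.\<close>
  also have "\<dots> \<le> (r / R) ^ Suc n"
    using \<open>1 < r / R\<close> by (intro power_increasing) auto
  finally show False
    using bound[of "Suc n"] by simp
qed

end
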